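(* Let $f\colon\{2,4,6\}\to\mathbb{N}$. If $f$ is realizable, then $f(4)=\tfrac12\big(f(2)+f(6)\big)$.
   Context: $\mathrm{dist}$ denotes Hamming distance. For a partial function $f$ from $\mathbb{N}$ to $\mathbb{N}$ with domain $\mathrm{dom}(f)\subseteq\mathbb{N}$, a map $E\colon\{0,1\}^n\to\{0,1\}^m$ is an $f$-code if $\mathrm{dist}(E(x),E(y))=f(\mathrm{dist}(x,y))$ for all $x,y\in\{0,1\}^n$ with $\mathrm{dist}(x,y)\in\mathrm{dom}(f)$. The function $f$ is realizable if there is a function $m\colon\mathbb{N}\to\mathbb{N}$ such that for infinitely many $n$ there exists an $f$-code $\{0,1\}^n\to\{0,1\}^{m(n)}$. *)

theory Defs
  imports Complex_Main "HOL-Library.FuncSet"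
begin

definition cube :: "nat \<Rightarrow> bool list set" where
  "cube n = {x. length x = n}"

(* Only meaningful for lists of equal length. *)
definition hamming_dist :: "'a list \<Rightarrow> 'a list \<Rightarrow> nat" where
  "hamming_dist x y = card {i. i < length x \<and> x ! i \<noteq> y ! i}"

(* The values of E outside cube n are irrelevant; E need not be injective. *)
definition is_code :: "(nat \<rightharpoonup> nat) \<Rightarrow> nat \<Rightarrow> nat \<Rightarrow> (bool list \<Rightarrow> bool list) \<Rightarrow> bool" where
  "is_code f n m E \<longleftrightarrow>
     E \<in> cube n \<rightarrow> cube m \<and>
     (\<forall>x\<in>cube n. \<forall>y\<in>cube n. hamming_dist x y \<in> dom f \<longrightarrow>
        hamming_dist (E x) (E y) = the (f (hamming_dist x y)))"

definition realizable :: "(nat \<rightharpoonup> nat) \<Rightarrow> bool" where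
  "realizable f \<longleftrightarrow>
     (\<exists>m :: nat \<Rightarrow> nat. infinite {n. \<exists>E. is_code f n (m n) E})"

end

theory Submission
  imports Defs
begin

text \<open>
  Identify words with subsets of \<open>{..<n}\<close> and normalise the code so that the empty set is mapped
  to the empty set; write \<open>S A\<close> for the image of \<open>A\<close> and \<open>a\<close>, \<open>b\<close>, \<open>d\<close> for the values of \<open>f\<close> at
  2, 4, 6. The sets \<open>S {i, j}\<close> with \<open>i\<close> fixed have size \<open>a\<close> and pairwise intersections of size
  \<open>a / 2\<close>; as there are many of them, they contain a common kernel \<open>K i\<close> of size \<open>a / 2\<close> outside of
  which they escape any given set of bounded size. Hence \<open>K i\<close> lies in every bounded set that meets
  all these \<open>S {i, j}\<close> in \<open>a / 2\<close> points. In particular \<open>K 0\<close> is contained in \<open>T = S {0, 1, 2, 3}\<close>,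
  and \<open>K j\<close> is contained in \<open>S {0, j}\<close>. For generic \<open>j\<close>, \<open>k\<close>, \<open>l\<close> this makes both
  \<open>S {j, k} \<inter> T\<close> and \<open>S {j, k} \<inter> S {0, l}\<close> equal to \<open>S {j, k} \<inter> K 0\<close>. The first set has
  \<open>(a + b - d) / 2\<close> elements, the second one \<open>(2 * a - b) / 2\<close>.
\<close>

text \<open>A weakened sunflower kernel: the petals \<open>S j - Y\<close> need not be disjoint, but
  some petal avoids any \<open>M\<close> prescribed points, even with \<open>M\<close> indices
  forbidden.\<close>

definition generic_kernel :: "nat \<Rightarrow> 'i set \<Rightarrow> ('i \<Rightarrow> 'a set) \<Rightarrow> 'a set \<Rightarrow> bool" where
  "generic_kernel M J S Y \<longleftrightarrow>
     (\<forall>B X. finite B \<and> card B \<le> M \<and> finite X \<and> card X \<le> M \<longrightarrow>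
        (\<exists>j\<in>J - X. Y \<subseteq> S j \<and> S j \<inter> B \<subseteq> Y))"

lemma generic_kernelE:
  assumes "generic_kernel M J S Y" "finite B" "card B \<le> M" "finite X" "card X \<le> M"
  obtains j where "j \<in> J" "j \<notin> X" "Y \<subseteq> S j" "S j \<inter> B \<subseteq> Y"
  using assms unfolding generic_kernel_def by blast

lemma pigeonhole_hitting:
  assumes "finite J" "finite B" and hit: "\<And>j. j \<in> J \<Longrightarrow> S j \<inter> B \<noteq> {}"
    and "card B * N < card J"
  shows "\<exists>p\<in>B. N \<le> card {j \<in> J. p \<in> S j}"
proof (rule ccontr)
  assume neg: "\<not> ?thesis"
  have "J \<subseteq> (\<Union>p\<in>B. {j \<in> J. p \<in> S j})" using hit by blast
  then have "card J \<le> card (\<Union>p\<in>B. {j \<in> J. p \<in> S j})"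
    using assms(1,2) by (intro card_mono) auto
  also have "\<dots> \<le> (\<Sum>p\<in>B. card {j \<in> J. p \<in> S j})"
    using assms(2) by (rule card_UN_le)
  also have "\<dots> \<le> (\<Sum>p\<in>B. N)"
    using neg by (intro sum_mono) (auto simp: not_le)
  finally show False using assms(4) by simp
qed

text \<open>Induction on the size bound \<open>k\<close>, as for sunflowers. If the empty set is no
  kernel, some bounded \<open>B\<close> meets all \<open>S j\<close> outside a bounded set of
  indices, so many \<open>S j\<close> share a point \<open>p\<close> of \<open>B\<close>; delete
  \<open>p\<close>, take a kernel of the rest and put \<open>p\<close> back.\<close>

lemma generic_kernel_exists:
  "\<exists>N. \<forall>J S. finite J \<and> N \<le> card J \<and> (\<forall>j\<in>J. finite (S j) \<and> card (S j) \<le> k) \<longrightarrow>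
     (\<exists>Y. generic_kernel M J (S :: 'i \<Rightarrow> 'a set) Y)"
proof (induction k)
  case 0
  have "generic_kernel M J S {}"
    if J: "finite J" "Suc M \<le> card J" "\<forall>j\<in>J. finite (S j) \<and> card (S j) \<le> 0"
    for J :: "'i set" and S :: "'i \<Rightarrow> 'a set"
    unfolding generic_kernel_def
  proof (intro allI impI)
    fix B :: "'a set" and X :: "'i set"
    assume "finite B \<and> card B \<le> M \<and> finite X \<and> card X \<le> M"
    then have "\<not> J \<subseteq> X" using card_mono[of X J] J by linarith
    then obtain j where "j \<in> J" "j \<notin> X" by blast
    moreover from this have "S j = {}" using J by auto
    ultimately show "\<exists>j\<in>J - X. {} \<subseteq> S j \<and> S j \<inter> B \<subseteq> {}" by auto
  qed
  then show ?case by blast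
next
  case (Suc k)
  then obtain N where N: "\<And>J (S :: 'i \<Rightarrow> 'a set). finite J \<Longrightarrow> N \<le> card J \<Longrightarrow>
      \<forall>j\<in>J. finite (S j) \<and> card (S j) \<le> k \<Longrightarrow> \<exists>Y. generic_kernel M J S Y"
    by metis
  \<comment> \<open>\<open>M\<close> indices may be lost to \<open>X\<close>; more than
    \<open>M * N\<close> remain, so one of the at most \<open>M\<close> points of \<open>B\<close>
    lies in at least \<open>N\<close> of their sets.\<close>
  have "\<exists>Y. generic_kernel M J S Y"
    if J: "finite J" "Suc (M + M * N) \<le> card J" "\<forall>j\<in>J. finite (S j) \<and> card (S j) \<le> Suc k"
    for J :: "'i set" and S :: "'i \<Rightarrow> 'a set"
  proof (cases "generic_kernel M J S {}")
    case True
    then show ?thesis by blast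
  next
    case False
    then obtain B X where BX: "finite B" "card B \<le> M" "finite X" "card X \<le> M"
      and hit: "\<And>j. j \<in> J - X \<Longrightarrow> S j \<inter> B \<noteq> {}"
      unfolding generic_kernel_def by auto
    have "card J - card X \<le> card (J - X)" using BX by (rule_tac diff_card_le_card_Diff)
    then have "M * N < card (J - X)" using J BX by linarith
    then have "card B * N < card (J - X)"
      using mult_le_mono1[OF BX(2), of N] by linarith
    then obtain p where p: "p \<in> B" "N \<le> card {j \<in> J - X. p \<in> S j}"
      using pigeonhole_hitting[of "J - X" B S N] hit BX J by blast
    let ?J = "{j \<in> J - X. p \<in> S j}"
    have "\<exists>Y. generic_kernel M ?J (\<lambda>j. S j - {p}) Y"
      using J p by (intro N) auto
    then obtain Y where Y: "generic_kernel M ?J (\<lambda>j. S j - {p}) Y" by blast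
    have "generic_kernel M J S (insert p Y)"
      unfolding generic_kernel_def
    proof (intro allI impI)
      fix B :: "'a set" and X :: "'i set"
      assume "finite B \<and> card B \<le> M \<and> finite X \<and> card X \<le> M"
      then obtain j where "j \<in> ?J" "j \<notin> X" "Y \<subseteq> S j - {p}" "(S j - {p}) \<inter> B \<subseteq> Y"
        using generic_kernelE[OF Y, of B X] by blast
      then show "\<exists>j\<in>J - X. insert p Y \<subseteq> S j \<and> S j \<inter> B \<subseteq> insert p Y"
        by blast
    qed
    then show ?thesis by blast
  qed
  then show ?case by blast
qed

text \<open>Genericity yields a \<open>j\<close> for which \<open>S j\<close> meets \<open>B\<close>
  only inside \<open>Y\<close>; by cardinality this intersection is all of \<open>Y\<close>.\<close>

lemma generic_kernel_subset:
  assumes "generic_kernel M J S Y" "finite B" "card B \<le> M" "finite X" "card X \<le> M"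
    and "finite Y" and le: "\<And>j. j \<in> J - X \<Longrightarrow> card Y \<le> card (S j \<inter> B)"
  shows "Y \<subseteq> B"
proof -
  obtain j where j: "j \<in> J" "j \<notin> X" "S j \<inter> B \<subseteq> Y"
    using assms(1-5) by (rule generic_kernelE)
  then have "S j \<inter> B = Y"
    using le[of j] \<open>finite Y\<close> by (intro card_seteq) auto
  then show ?thesis by blast
qed

text \<open>\<open>Y\<close> is itself one of the pairwise intersections: given \<open>S i\<close>
  containing \<open>Y\<close>, apply genericity to the points of \<open>S i\<close> with
  \<open>i\<close> forbidden.\<close>

lemma generic_kernel_card:
  assumes Y: "generic_kernel M J S Y" and "1 \<le> M"
    and S: "\<And>j. j \<in> J \<Longrightarrow> finite (S j) \<and> card (S j) \<le> M"
    and int: "\<And>i j. i \<in> J \<Longrightarrow> j \<in> J \<Longrightarrow> i \<noteq> j \<Longrightarrow> 2 * card (S i \<inter> S j) = a"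
  shows "finite Y" "2 * card Y = a"
proof -
  obtain i where i: "i \<in> J" "Y \<subseteq> S i"
    using generic_kernelE[OF Y, of "{}" "{}"] by auto
  show "finite Y" using i S by (meson finite_subset)
  obtain j where j: "j \<in> J" "j \<noteq> i" "Y \<subseteq> S j" "S j \<inter> S i \<subseteq> Y"
    using generic_kernelE[OF Y, of "S i" "{i}"] S[OF i(1)] \<open>1 \<le> M\<close> by auto
  then have "S i \<inter> S j = Y" using i by blast
  then show "2 * card Y = a" using int i j by metis
qed

lemma card_sym_diff_inter:
  assumes "finite A" "finite B"
  shows "card (sym_diff A B) + 2 * card (A \<inter> B) = card A + card B"
proof -
  have "card (sym_diff A B) = card (A - B) + card (B - A)"
    using assms by (intro card_Un_disjoint) auto
  moreover have "card A = card (A \<inter> B) + card (A - B)" "card B = card (A \<inter> B) + card (B - A)"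
    using card_Int_Diff[OF assms(1), of B] card_Int_Diff[OF assms(2), of A]
    by (simp_all add: Int_commute)
  ultimately show ?thesis by linarith
qed

text \<open>The length of the code words survives only as finiteness, so the bound on
  \<open>n\<close> obtained below does not depend on it.\<close>

definition set_code :: "(nat \<Rightarrow> nat) \<Rightarrow> nat \<Rightarrow> (nat set \<Rightarrow> nat set) \<Rightarrow> bool" where
  "set_code g n S \<longleftrightarrow> S {} = {} \<and> (\<forall>A. finite (S A)) \<and>
     (\<forall>A B. A \<subseteq> {..<n} \<and> B \<subseteq> {..<n} \<and> card (sym_diff A B) \<in> {2, 4, 6} \<longrightarrow>
        card (sym_diff (S A) (S B)) = g (card (sym_diff A B)))"

lemma set_code_values:
  "\<exists>N. \<forall>n\<ge>N. \<forall>S. set_code g n S \<longrightarrow> 2 * g 4 = g 2 + g 6"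
proof -
  define a b d where "a = g 2" and "b = g 4" and "d = g 6"
  \<comment> \<open>Large enough for every set to be avoided, of size \<open>a\<close> (a pair
    image) or \<open>b\<close> (the set \<open>T\<close>), and for forbidding up to two
    indices.\<close>
  define M where "M = a + b + 2"
  obtain N where N: "\<And>J (S :: nat \<Rightarrow> nat set). finite J \<Longrightarrow> N \<le> card J \<Longrightarrow>
      \<forall>j\<in>J. finite (S j) \<and> card (S j) \<le> a \<Longrightarrow> \<exists>Y. generic_kernel M J S Y"
    using generic_kernel_exists[of a M] by metis
  have "2 * b = a + d"
    if n: "N + 5 \<le> n" and S: "set_code g n S" for n and S :: "nat set \<Rightarrow> nat set"
  proof -
    have S0: "S {} = {}" and fin: "\<And>A. finite (S A)"
      using S unfolding set_code_def by auto
    have dist: "card (sym_diff (S A) (S B)) = g (card (sym_diff A B))"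
      if "A \<subseteq> {..<n}" "B \<subseteq> {..<n}" "card (sym_diff A B) \<in> {2, 4, 6}" for A B
      using S that unfolding set_code_def by blast
    have d2: "card (sym_diff (S A) (S B)) = a"
      if "A \<subseteq> {..<n}" "B \<subseteq> {..<n}" "card (sym_diff A B) = 2" for A B
      using dist[OF that(1,2)] that(3) by (simp add: a_def)
    have d4: "card (sym_diff (S A) (S B)) = b"
      if "A \<subseteq> {..<n}" "B \<subseteq> {..<n}" "card (sym_diff A B) = 4" for A B
      using dist[OF that(1,2)] that(3) by (simp add: b_def)
    have d6: "card (sym_diff (S A) (S B)) = d"
      if "A \<subseteq> {..<n}" "B \<subseteq> {..<n}" "card (sym_diff A B) = 6" for A B
      using dist[OF that(1,2)] that(3) by (simp add: d_def)
    note inter = card_sym_diff_inter[OF fin fin]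
    have pair: "card (S {i, j}) = a" if "i < n" "j < n" "i \<noteq> j" for i j
      using d2[of "{i, j}" "{}"] that S0 by simp
    have star: "2 * card (S {i, j} \<inter> S {i, k}) = a"
      if "i < n" "j < n" "k < n" "i \<noteq> j" "i \<noteq> k" "j \<noteq> k" for i j k
    proof -
      have "sym_diff {i, j} {i, k} = {j, k}" using that by auto
      then have "card (sym_diff (S {i, j}) (S {i, k})) = a" using d2 that by simp
      then show ?thesis using inter[of "{i, j}" "{i, k}"] pair that by simp
    qed
    have star_kernel: "\<exists>Y. generic_kernel M I (\<lambda>j. S {i, j}) Y \<and> finite Y \<and> 2 * card Y = a"
      if i: "i < n" and I: "I \<subseteq> {..<n} - {i}" "N \<le> card I" for i I
    proof -
      have S: "finite (S {i, j}) \<and> card (S {i, j}) = a" if "j \<in> I" for j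
        using that i I fin pair by auto
      have int: "2 * card (S {i, j} \<inter> S {i, k}) = a" if "j \<in> I" "k \<in> I" "j \<noteq> k" for j k
        using that i I by (intro star) auto
      have "finite I" using I(1) by (rule finite_subset) simp
      then obtain Y where Y: "generic_kernel M I (\<lambda>j. S {i, j}) Y"
        using N[of I "\<lambda>j. S {i, j}"] I(2) S by auto
      have "finite (S {i, j}) \<and> card (S {i, j}) \<le> M" if "j \<in> I" for j
        using S[OF that] by (simp add: M_def)
      then show ?thesis using generic_kernel_card[OF Y _ _ int] Y by (auto simp: M_def)
    qed
    define T where "T = S {0, 1, 2, 3}"
    have T: "card T = b" unfolding T_def using d4[of "{0, 1, 2, 3}" "{}"] n S0 by simp
    have T_le: "finite T" "card T \<le> M" using T fin by (auto simp: T_def M_def)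
    have empty_le: "finite ({} :: nat set)" "card ({} :: nat set) \<le> M" by auto
    \<comment> \<open>Indices from 4 on keep clear of 0, 1, 2, 3. As \<open>N + 5 \<le> n\<close>,
      at least \<open>N\<close> of them remain even after one is removed.\<close>
    define J where "J = {4..<n}"
    have J: "\<And>j. j \<in> J \<Longrightarrow> 3 < j \<and> j < n" unfolding J_def by auto

    have "0 < n" "J \<subseteq> {..<n} - {0}" "N \<le> card J"
      using n by (auto simp: J_def)
    then obtain K where K: "generic_kernel M J (\<lambda>j. S {0, j}) K"
      and cardK: "finite K" "2 * card K = a"
      using star_kernel by blast
    have "2 * card (S {0, j} \<inter> T) = a" if j: "j \<in> J" for j
    proof -
      have "sym_diff {0, j} {0, 1, 2, 3} = {j, 1, 2, 3}" using J[OF j] by auto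
      then have "card (sym_diff (S {0, j}) T) = b"
        unfolding T_def using d4[of "{0, j}" "{0, 1, 2, 3}"] J[OF j] by simp
      then show ?thesis
        using inter[of "{0, j}" "{0, 1, 2, 3}"] pair[of 0 j] T J[OF j] unfolding T_def by simp
    qed
    then have "card K \<le> card (S {0, j} \<inter> T)" if "j \<in> J" for j using that cardK by force
    then have KT: "K \<subseteq> T"
      by (intro generic_kernel_subset[OF K T_le empty_le cardK(1)]) auto

    \<comment> \<open>With this \<open>j\<close>, any subset of \<open>S {0, j}\<close> meets
      \<open>T\<close> only inside \<open>K\<close>; this will be applied to the kernel
      \<open>L\<close> of the star at \<open>j\<close>.\<close>
    obtain j where j: "j \<in> J" "S {0, j} \<inter> T \<subseteq> K"
      using generic_kernelE[OF K T_le empty_le] by blast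
    have "j < n" "J - {j} \<subseteq> {..<n} - {j}" "N \<le> card (J - {j})"
      using j n by (auto simp: J_def)
    then obtain L where L: "generic_kernel M (J - {j}) (\<lambda>k. S {j, k}) L"
      and cardL: "finite L" "2 * card L = a"
      using star_kernel by blast
    have "2 * card (S {j, k} \<inter> S {0, j}) = a" if "k \<in> J - {j}" for k
      using star[of j k 0] J[of j] J[of k] j that by (auto simp: insert_commute)
    then have "card L \<le> card (S {j, k} \<inter> S {0, j})" if "k \<in> J - {j}" for k
      using that cardL by force
    moreover have "card (S {0, j}) \<le> M" using pair[of 0 j] J[of j] j by (simp add: M_def)
    ultimately have LS: "L \<subseteq> S {0, j}"
      by (intro generic_kernel_subset[OF L fin _ empty_le cardL(1)]) auto

    \<comment> \<open>Now \<open>S {j, k} \<inter> T\<close> lies in \<open>L\<close>, hence in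
      \<open>S {0, j} \<inter> T\<close>, hence in \<open>K\<close>.\<close>
    obtain k where k: "k \<in> J - {j}" "S {j, k} \<inter> T \<subseteq> L"
      using generic_kernelE[OF L T_le empty_le] by blast
    have jk: "3 < j" "j < n" "3 < k" "k < n" "j \<noteq> k" using J[of j] J[of k] j k by auto
    have "card (S {j, k}) \<le> M" "finite {j, k}" "card {j, k} \<le> M"
      using pair jk by (simp_all add: M_def)
    then obtain l where l: "l \<in> J" "l \<notin> {j, k}" "K \<subseteq> S {0, l}" "S {0, l} \<inter> S {j, k} \<subseteq> K"
      using generic_kernelE[OF K fin] by blast
    \<comment> \<open>Both sides lie in \<open>K\<close>, while \<open>K\<close> lies in both
      \<open>T\<close> and \<open>S {0, l}\<close>; so both equal
      \<open>S {j, k} \<inter> K\<close>.\<close>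
    have eq: "S {j, k} \<inter> T = S {0, l} \<inter> S {j, k}" using l k j KT LS by blast
    have "sym_diff {0, l} {j, k} = {0, l, j, k}" using l jk by auto
    then have "card (sym_diff (S {0, l}) (S {j, k})) = b"
      using d4[of "{0, l}" "{j, k}"] l jk J[of l] by simp
    then have 1: "b + 2 * card (S {0, l} \<inter> S {j, k}) = a + a"
      using inter[of "{0, l}" "{j, k}"] pair[of 0 l] pair[of j k] l jk J[of l] by simp
    have "sym_diff {j, k} {0, 1, 2, 3} = {j, k, 0, 1, 2, 3}" using jk by auto
    then have "card (sym_diff (S {j, k}) T) = d"
      using d6[of "{j, k}" "{0, 1, 2, 3}"] jk by (simp add: T_def)
    then have "d + 2 * card (S {j, k} \<inter> T) = a + b"
      using inter[of "{j, k}" "{0, 1, 2, 3}"] pair[of j k] T jk by (simp add: T_def)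
    with 1 eq show ?thesis by simp
  qed
  then show ?thesis unfolding a_def b_def d_def by blast
qed

lemma hamming_dist_indicator:
  assumes "A \<subseteq> {..<n}" "B \<subseteq> {..<n}"
  shows "hamming_dist (map (\<lambda>i. i \<in> A) [0..<n]) (map (\<lambda>i. i \<in> B) [0..<n])
    = card (sym_diff A B)"
  unfolding hamming_dist_def using assms by (intro arg_cong[where f = card]) auto

text \<open>With only two letters, \<open>x\<close> and \<open>y\<close> differ at a position iff
  exactly one of them differs from \<open>z\<close> there. Thus any word \<open>z\<close> can serve
  as the origin.\<close>

lemma hamming_dist_sym_diff:
  fixes x y z :: "bool list"
  assumes "length x = m" "length y = m" "length z = m"
  shows "hamming_dist x y
    = card (sym_diff {i. i < m \<and> x ! i \<noteq> z ! i} {i. i < m \<and> y ! i \<noteq> z ! i})"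
  unfolding hamming_dist_def using assms by (intro arg_cong[where f = card]) auto

theorem theorem1p9:
  fixes f :: "nat \<rightharpoonup> nat"
  assumes "dom f = {2, 4, 6}"
    and "realizable f"
  shows "real (the (f 4)) = 1 / 2 * (real (the (f 2)) + real (the (f 6)))"
proof -
  obtain m where m: "infinite {n. \<exists>E. is_code f n (m n) E}"
    using assms(2) unfolding realizable_def by blast
  obtain N where N: "\<And>n S. N \<le> n \<Longrightarrow> set_code (\<lambda>i. the (f i)) n S \<Longrightarrow>
      2 * the (f 4) = the (f 2) + the (f 6)"
    using set_code_values[of "\<lambda>i. the (f i)"] by blast
  have "\<not> {n. \<exists>E. is_code f n (m n) E} \<subseteq> {..<N}"
    using m finite_subset by blast
  then obtain n E where n: "N \<le> n" and E: "is_code f n (m n) E"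
    using not_le_imp_less by blast
  define w where "w A = map (\<lambda>i. i \<in> A) [0..<n]" for A
  \<comment> \<open>Taking the image of the zero word as origin gives
    \<open>S {} = {}\<close>.\<close>
  define S where "S A = {i. i < m n \<and> E (w A) ! i \<noteq> E (w {}) ! i}" for A
  have w: "w A \<in> cube n" for A unfolding w_def cube_def by simp
  have len: "length (E (w A)) = m n" for A
    using E w[of A] unfolding is_code_def cube_def by blast
  have dist: "card (sym_diff (S A) (S B)) = the (f (card (sym_diff A B)))"
    if "A \<subseteq> {..<n}" "B \<subseteq> {..<n}" "card (sym_diff A B) \<in> {2, 4, 6}" for A B
  proof -
    have h: "hamming_dist (w A) (w B) = card (sym_diff A B)"
      unfolding w_def using that by (intro hamming_dist_indicator)
    then have "hamming_dist (w A) (w B) \<in> dom f" using that(3) assms(1) by simp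
    then have "hamming_dist (E (w A)) (E (w B)) = the (f (card (sym_diff A B)))"
      using E w[of A] w[of B] h unfolding is_code_def by simp
    then show ?thesis
      unfolding S_def hamming_dist_sym_diff[OF len[of A] len[of B] len[of "{}"]] .
  qed
  then have "set_code (\<lambda>i. the (f i)) n S"
    unfolding set_code_def by (auto simp: S_def)
  then have "2 * the (f 4) = the (f 2) + the (f 6)" by (rule N[OF n])
  then have "2 * real (the (f 4)) = real (the (f 2)) + real (the (f 6))" by linarith
  then show ?thesis by (simp add: field_simps)
qed

end
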